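(* Let $\Phi(z)=\sum_{n\ge0}z^{2^n}$ and $\mathrm{Cat}_n=\frac1{n+1}\binom{2n}{n}$. Then, modulo $4096$, $$\sum_{n=0}^\infty \mathrm{Cat}_n z^n=\sum_{i=0}^{15}a_i(z)\,\Phi^i(z),$$ where \begin{align*} a_0(z)&=2048z^{14}+3072z^{13}+2048z^{12}+3584z^{11}+640z^{10}+2240z^9+32z^8+832z^7+2412z^6\\ &\quad+1042z^5+2702z^4+53z^3+2z^2+z+1,\\ a_1(z)&=2048z^{12}+3840z^{10}+2112z^8+2112z^7+552z^6+3128z^5+2512z^4+4000z^3+3904z^2,\\ a_2(z)&=2048z^{13}+3072z^{11}+1536z^{10}+1152z^9+1024z^8+4000z^7+3440z^6+3788z^5+3096z^4\\ &\quad+3416z^3+2368z^2+288z,\\ a_3(z)&=2048z^{11}+2048z^{10}+2304z^9+512z^8+2752z^7+3072z^6+728z^5+3528z^4+1032z^3\\ &\quad+3168z^2+3456z+3904,\\ a_4(z)&=2048z^{12}+3072z^{11}+1024z^{10}+2048z^9+1152z^8+1728z^7+2272z^6+2464z^5+3452z^4\\ &\quad+3154z^3+2136z^2+3896z+1600+\tfrac{48}{z},\\ a_5(z)&=2048z^{10}+2048z^9+1792z^8+1792z^7+1088z^6+1536z^5+1704z^4+3648z^3+3288z^2\\ &\quad+200z+3728+\tfrac{2272}{z},\\ a_6(z)&=2048z^{11}+1024z^9+1536z^8+3200z^7+2816z^6+1312z^5+3824z^4+140z^3+592z^2\\ &\quad+3692z+488+\tfrac{2760}{z},\\ a_7(z)&=2048z^9+2304z^7+2304z^6+3520z^5+960z^4+2456z^3+2128z^2+2936z+1784+\tfrac{4024}{z},\\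 a_8(z)&=2048z^{10}+1024z^9+2048z^8+512z^7+3968z^6+1088z^5+1888z^4+832z^3+1444z^2\\ &\quad+2646z+3258+\tfrac{339}{z},\\ a_9(z)&=2048z^8+3328z^6+1536z^5+3008z^4+320z^3+2168z^2+1144z+3992+\tfrac{3152}{z},\\ a_{10}(z)&=2048z^9+3072z^7+512z^6+1408z^5+2560z^4+3424z^3+3408z^2+1316z+3608+\tfrac{2380}{z},\\ a_{11}(z)&=2048z^7+2048z^6+2816z^5+3072z^4+1856z^3+2688z^2+1288z+3880+\tfrac{3904}{z},\\ a_{12}(z)&=2048z^8+1024z^7+3072z^6+2048z^5+1408z^4+2624z^3+1440z^2+224z+948+\tfrac{358}{z},\\ a_{13}(z)&=2048z^6+2048z^5+3328z^4+2816z^3+1984z^2+384z+2488+\tfrac{2384}{z},\\ a_{14}(z)&=2048z^7+1024z^5+512z^4+2432z^3+1792z^2+3040z+336+\tfrac{260}{z},\\ a_{15}(z)&=2048z^5+768z^3+256z^2+64z+2752+\tfrac{2696}{z}. \end{align*}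
   Context: For formal Laurent series with integer coefficients, an equality "modulo $M$" means that coefficients of equal powers of $z$ agree modulo $M$. $\Phi^i(z)$ denotes $(\Phi(z))^i$. *)

theory Defs
  imports
    "HOL-Computational_Algebra.Formal_Laurent_Series"
    "HOL-Number_Theory.Cong"
begin

definition fls_cong :: "int fls \<Rightarrow> int fls \<Rightarrow> int \<Rightarrow> bool" where
  "fls_cong f g M \<longleftrightarrow> (\<forall>k::int. [fls_nth f k = fls_nth g k] (mod M))"

(* The division on nat is exact, see of_nat_catalan below. *)
definition catalan :: "nat \<Rightarrow> nat" where
  "catalan n = ((2 * n) choose n) div (n + 1)"

lemma Suc_dvd_central_binomial: "n + 1 dvd ((2 * n) choose n)"
proof (cases n)
  case (Suc m)
  have "(n + 1) * ((2 * n) choose (n + 1)) = n * ((2 * n) choose n)"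
    using binomial_absorb_comp[of "2 * n" n] binomial_absorption[of n "2 * n"]
    by (simp add: mult_2)
  then have "n + 1 dvd n * ((2 * n) choose n)"
    by (metis dvd_triv_left)
  moreover have "coprime (n + 1) n"
    by simp
  ultimately show ?thesis
    by (simp only: coprime_dvd_mult_right_iff)
qed simp

lemma of_nat_catalan:
  "(of_nat (catalan n) :: 'a :: field_char_0) = 1 / of_nat (n + 1) * of_nat ((2 * n) choose n)"
proof -
  have "of_nat (catalan n) * (of_nat (n + 1) :: 'a) = of_nat ((2 * n) choose n)"
    unfolding catalan_def using Suc_dvd_central_binomial[of n]
    by (metis dvd_div_mult_self of_nat_mult)
  moreover have "(of_nat (n + 1) :: 'a) \<noteq> 0"
    by (metis Suc_eq_plus1 of_nat_neq_0)
  ultimately show ?thesis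
    by (simp add: nonzero_eq_divide_eq del: of_nat_add)
qed

definition catalan_series :: "int fls" where
  "catalan_series = fps_to_fls (Abs_fps (\<lambda>n. int (catalan n)))"

(* Infinite sum with respect to the formal (X-adic) topology on power series. *)
definition Phi :: "int fls" where
  "Phi = fps_to_fls (\<Sum>n. fps_X ^ (2 ^ n))"

lemma sums_Phi_fps:
  "(\<lambda>n. fps_X ^ (2 ^ n) :: int fps) sums Abs_fps (\<lambda>m. if \<exists>k. m = 2 ^ k then 1 else 0)"
  unfolding sums_def
proof (rule tendsto_fpsI)
  fix m :: nat
  show "\<forall>\<^sub>F N in sequentially. fps_nth (\<Sum>n<N. fps_X ^ (2 ^ n) :: int fps) m =
          fps_nth (Abs_fps (\<lambda>m. if \<exists>k. m = 2 ^ k then 1 else 0)) m"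
  proof (rule eventually_sequentiallyI[of "Suc m"])
    fix N assume N: "Suc m \<le> N"
    have *: "fps_nth (\<Sum>n<N. fps_X ^ (2 ^ n) :: int fps) m = (\<Sum>n<N. if m = 2 ^ n then 1 else 0)"
      by (simp add: fps_sum_nth fps_X_power_nth)
    show "fps_nth (\<Sum>n<N. fps_X ^ (2 ^ n) :: int fps) m =
            fps_nth (Abs_fps (\<lambda>m. if \<exists>k. m = 2 ^ k then 1 else 0)) m"
    proof (cases "\<exists>k. m = 2 ^ k")
      case True
      then obtain k where k: "m = 2 ^ k" by blast
      have "k < N"
        using less_exp[of k] k N by linarith
      then show ?thesis
        using True unfolding * by (simp add: k sum.delta)
    next
      case False
      then show ?thesis unfolding * by (auto intro!: sum.neutral)
    qed
  qed
qed

lemma Phi_nth: "fls_nth Phi k = (if \<exists>n. k = 2 ^ n then 1 else 0)"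
proof -
  have Phi: "Phi = fps_to_fls (Abs_fps (\<lambda>m. if \<exists>n. m = 2 ^ n then 1 else 0))"
    unfolding Phi_def using sums_unique[OF sums_Phi_fps] by simp
  show ?thesis
  proof (cases "k \<ge> 0")
    case True
    then have "nat k = 2 ^ n \<longleftrightarrow> k = 2 ^ n" for n
      by (simp add: nat_eq_iff)
    then show ?thesis using True by (simp add: Phi)
  next
    case False
    then have "k \<noteq> 2 ^ n" for n
      by (metis zero_le_power zero_le_numeral)
    then show ?thesis using False by (simp add: Phi)
  qed
qed

(* Entry i is a_i(z), with z' = 1/z. *)
definition cat_coeff_list :: "int fls list" where
  "cat_coeff_list = (let z = fls_X; z' = fls_X_inv in [
      2048*z^14 + 3072*z^13 + 2048*z^12 + 3584*z^11 + 640*z^10 + 2240*z^9 + 32*z^8 + 832*z^7 +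
      2412*z^6 + 1042*z^5 + 2702*z^4 + 53*z^3 + 2*z^2 + z + 1,
      2048*z^12 + 3840*z^10 + 2112*z^8 + 2112*z^7 + 552*z^6 + 3128*z^5 + 2512*z^4 + 4000*z^3 +
      3904*z^2,
      2048*z^13 + 3072*z^11 + 1536*z^10 + 1152*z^9 + 1024*z^8 + 4000*z^7 + 3440*z^6 + 3788*z^5
      + 3096*z^4 + 3416*z^3 + 2368*z^2 + 288*z,
      2048*z^11 + 2048*z^10 + 2304*z^9 + 512*z^8 + 2752*z^7 + 3072*z^6 + 728*z^5 + 3528*z^4 +
      1032*z^3 + 3168*z^2 + 3456*z + 3904,
      2048*z^12 + 3072*z^11 + 1024*z^10 + 2048*z^9 + 1152*z^8 + 1728*z^7 + 2272*z^6 + 2464*z^5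
      + 3452*z^4 + 3154*z^3 + 2136*z^2 + 3896*z + 1600 + 48*z',
      2048*z^10 + 2048*z^9 + 1792*z^8 + 1792*z^7 + 1088*z^6 + 1536*z^5 + 1704*z^4 + 3648*z^3 +
      3288*z^2 + 200*z + 3728 + 2272*z',
      2048*z^11 + 1024*z^9 + 1536*z^8 + 3200*z^7 + 2816*z^6 + 1312*z^5 + 3824*z^4 + 140*z^3 +
      592*z^2 + 3692*z + 488 + 2760*z',
      2048*z^9 + 2304*z^7 + 2304*z^6 + 3520*z^5 + 960*z^4 + 2456*z^3 + 2128*z^2 + 2936*z +
      1784 + 4024*z',
      2048*z^10 + 1024*z^9 + 2048*z^8 + 512*z^7 + 3968*z^6 + 1088*z^5 + 1888*z^4 + 832*z^3 +
      1444*z^2 + 2646*z + 3258 + 339*z',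
      2048*z^8 + 3328*z^6 + 1536*z^5 + 3008*z^4 + 320*z^3 + 2168*z^2 + 1144*z + 3992 + 3152*z',
      2048*z^9 + 3072*z^7 + 512*z^6 + 1408*z^5 + 2560*z^4 + 3424*z^3 + 3408*z^2 + 1316*z +
      3608 + 2380*z',
      2048*z^7 + 2048*z^6 + 2816*z^5 + 3072*z^4 + 1856*z^3 + 2688*z^2 + 1288*z + 3880 +
      3904*z',
      2048*z^8 + 1024*z^7 + 3072*z^6 + 2048*z^5 + 1408*z^4 + 2624*z^3 + 1440*z^2 + 224*z + 948
      + 358*z',
      2048*z^6 + 2048*z^5 + 3328*z^4 + 2816*z^3 + 1984*z^2 + 384*z + 2488 + 2384*z',
      2048*z^7 + 1024*z^5 + 512*z^4 + 2432*z^3 + 1792*z^2 + 3040*z + 336 + 260*z',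
      2048*z^5 + 768*z^3 + 256*z^2 + 64*z + 2752 + 2696*z'])"

lemma length_cat_coeff_list: "length cat_coeff_list = 16"
  by (simp add: cat_coeff_list_def Let_def)

definition cat_coeff :: "nat \<Rightarrow> int fls" where
  "cat_coeff i = cat_coeff_list ! i"

end

(* Multiplying by z clears the denominators: B = z * sum a_i Phi^i is a polynomial in z and Phi,
   and D = z * sum Cat_n z^n is the root without constant term of D^2 - D + z = 0.  Since
   (B - D) (B + D - 1) = (B^2 - B + z) - (D^2 - D + z) and B + D - 1 has constant term -1, it is enough
   that 4096 divides B^2 - B + z.  From Phi(z^2) = Phi(z) - z one obtains a monic quartic P over Z[z]
   with P(Phi) = 0 modulo 8, and in the P-adic expansion sum r_j P^j of the polynomial B^2 - B + z
   every r_j with j < 4 is divisible by 8^(4-j); hence B^2 - B + z vanishes modulo 8^4 = 4096. *)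
theory Submission
  imports Defs
begin

section \<open>Divisibility of integer power series\<close>

lemma fps_const_dvd_iff: "fps_const (c :: int) dvd f \<longleftrightarrow> (\<forall>n. c dvd f $ n)"
proof
  assume "\<forall>n. c dvd f $ n"
  then have "f = fps_const c * Abs_fps (\<lambda>n. f $ n div c)"
    by (simp add: fps_eq_iff)
  then show "fps_const c dvd f" by (rule dvdI)
qed (auto elim!: dvdE)

text \<open>An inverse \<open>c\<close> of the constant term makes \<open>g\<close> a unit among
  integer power series, so \<open>g\<close> can be cancelled.\<close>

lemma fps_dvd_mult_unit_cancel:
  fixes f g :: "int fps"
  assumes "h dvd f * g" and "g $ 0 * c = 1"
  shows "h dvd f"
proof -
  have "g * fps_right_inverse g c = 1"
    using assms(2) by (rule fps_right_inverse)
  then have "f = f * g * fps_right_inverse g c"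
    by (simp add: mult.assoc)
  then show ?thesis
    using assms(1) by (metis dvd_mult2)
qed

lemma fps_compose_X_square_nth:
  "(f oo fps_X ^ 2) $ n = (if even n then (f :: int fps) $ (n div 2) else 0)"
proof -
  have "(f oo fps_X ^ 2) $ n = (\<Sum>i=0..n. if n = 2 * i then f $ i else 0)"
    by (simp add: fps_compose_nth power_mult [symmetric] if_distrib cong: if_cong)
  also have "\<dots> = (\<Sum>i=0..n. if i = n div 2 \<and> even n then f $ i else 0)"
    by (intro sum.cong) auto
  also have "\<dots> = (if even n then f $ (n div 2) else 0)"
    by (cases "even n") (simp_all add: sum.delta)
  finally show ?thesis .
qed

text \<open>The coefficient of X^n in f(X^2) is that of X^(n/2) in f, or 0 for odd n. Hence f(X^2) =
  f modulo c carries divisibility from n/2 up to n.\<close>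

lemma fps_const_dvd_of_compose_X_square:
  fixes f :: "int fps"
  assumes dvd: "fps_const c dvd (f oo fps_X ^ 2) - f" and 0: "f $ 0 = 0"
  shows "fps_const c dvd f"
  unfolding fps_const_dvd_iff
proof
  fix n show "c dvd f $ n"
  proof (induction n rule: less_induct)
    case (less n)
    have *: "c dvd (f oo fps_X ^ 2) $ n - f $ n"
      using dvd by (simp only: fps_const_dvd_iff fps_sub_nth)
    show ?case
    \<comment> \<open>\<open>n > 0\<close> gives \<open>n div 2 < n\<close>. At n = 0 the difference
      carries no information and the hypothesis on \<open>f $ 0\<close> is used.\<close>
    proof (cases "n > 0 \<and> even n")
      case True
      then have "c dvd f $ (n div 2)" by (intro less.IH) simp
      then show ?thesis
        using * True by (simp add: fps_compose_X_square_nth dvd_diff_right_iff)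
    next
      case False
      then show ?thesis
        using * 0 by (cases "n = 0") (simp_all add: fps_compose_X_square_nth)
    qed
  qed
qed

section \<open>The power series of the Catalan numbers and of the powers of two\<close>

lemma Suc_mult_catalan: "(n + 1) * catalan n = (2 * n) choose n"
  unfolding catalan_def using Suc_dvd_central_binomial by (rule dvd_mult_div_cancel)

lemma central_binomial_Suc:
  "(n + 1) * ((2 * (n + 1)) choose (n + 1)) = 2 * (2 * n + 1) * ((2 * n) choose n)"
proof -
  have 1: "(n + 1) * ((2 * n + 2) choose (n + 1)) = (2 * n + 2) * ((2 * n + 1) choose n)"
    using binomial_absorption[of n "2 * n + 2"] by simp
  have 2: "(n + 1) * ((2 * n + 1) choose n) = (2 * n + 1) * ((2 * n) choose n)"
    using binomial_absorb_comp[of "2 * n + 1" n] by simp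
  have "(n + 1) * ((n + 1) * ((2 * n + 2) choose (n + 1))) =
      (2 * n + 2) * ((n + 1) * ((2 * n + 1) choose n))"
    unfolding 1 by (rule mult.left_commute)
  also have "\<dots> = (n + 1) * (2 * (2 * n + 1) * ((2 * n) choose n))"
    unfolding 2 by (simp add: algebra_simps)
  finally have "(n + 1) * ((2 * n + 2) choose (n + 1)) = 2 * (2 * n + 1) * ((2 * n) choose n)"
    by (metis mult_cancel1 add_is_0 one_neq_zero)
  then show ?thesis by simp
qed

lemma catalan_Suc: "(n + 2) * catalan (n + 1) = 2 * (2 * n + 1) * catalan n"
proof -
  have "(n + 1) * ((n + 2) * catalan (n + 1)) = (n + 1) * (2 * (2 * n + 1) * catalan n)"
    using central_binomial_Suc[of n] Suc_mult_catalan[of n] Suc_mult_catalan[of "n + 1"]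
    by (metis (no_types, lifting) ab_semigroup_mult_class.mult_ac(1) add.assoc mult.left_commute
        one_add_one)
  then show ?thesis
    by (metis mult_cancel1 add_is_0 one_neq_zero)
qed

definition catalan_fps :: "int fps" where
  "catalan_fps = Abs_fps (\<lambda>n. int (catalan n))"

(* The recurrence gives (1 - 4 X) D' = 1 - 2 D, hence (1 - 4 X) V' = - 4 V for V = D^2 - D + X, and this
   differential equation has no nonzero solution with V $ 0 = 0. *)
lemma X_catalan_fps_eqn:
  defines "D \<equiv> fps_X * catalan_fps"
  shows "D ^ 2 - D + fps_X = 0"
proof -
  define V where "V = D ^ 2 - D + fps_X"
  have "(1 - 4 * fps_X) * fps_deriv D = 1 - 2 * D"
  proof (rule fps_ext)
    fix n
    show "((1 - 4 * fps_X) * fps_deriv D) $ n = (1 - 2 * D) $ n"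
    proof (cases n)
      case 0
      then show ?thesis
        by (simp add: D_def catalan_fps_def catalan_def left_diff_distrib mult.assoc
            numeral_fps_const)
    next
      case (Suc m)
      have "(int m + 2) * int (catalan (m + 1)) = 2 * (2 * int m + 1) * int (catalan m)"
        using arg_cong[OF catalan_Suc[of m], of int]
        by (simp only: of_nat_mult of_nat_add of_nat_numeral of_nat_1)
      then show ?thesis using Suc
        by (simp add: D_def catalan_fps_def left_diff_distrib mult.assoc numeral_fps_const
            algebra_simps)
    qed
  qed
  moreover have "fps_deriv V = 2 * D * fps_deriv D - fps_deriv D + 1"
    by (simp add: V_def fps_deriv_power numeral_fps_const)
  \<comment> \<open>Substituting for (1 - 4 X) D' leaves (2 D - 1) (1 - 2 D) + 1 - 4 X, which is -4
    (D^2 - D + X).\<close>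
  ultimately have "(1 - 4 * fps_X) * fps_deriv V = - 4 * V"
    unfolding V_def by algebra
  then have *: "((1 - 4 * fps_X) * fps_deriv V) $ n = (- 4 * V) $ n" for n
    by simp
  have rec: "(int n + 1) * V $ (n + 1) = 4 * (int n - 1) * V $ n" for n
    using *[of n] by (cases n) (simp_all add: left_diff_distrib mult.assoc numeral_fps_const
        algebra_simps)
  have "V $ n = 0" for n
  proof (induction n)
    case 0
    then show ?case by (simp add: V_def D_def power2_eq_square)
  next
    case (Suc n)
    then show ?case using rec[of n] by simp
  qed
  then show ?thesis
    unfolding V_def[symmetric] by (simp add: fps_eq_iff)
qed

definition Phi_fps :: "int fps" where
  "Phi_fps = Abs_fps (\<lambda>m. if \<exists>k. m = 2 ^ k then 1 else 0)"

lemma Phi_eq_fps_to_fls: "Phi = fps_to_fls Phi_fps"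
  unfolding Phi_def Phi_fps_def using sums_unique[OF sums_Phi_fps] by simp

lemma Phi_fps_nth_0: "Phi_fps $ 0 = 0"
  by (simp add: Phi_fps_def)

text \<open>Doubling every exponent maps 2^k to 2^(k+1), so only the term with exponent 2^0 is
  lost.\<close>

lemma Phi_fps_compose_X_square: "Phi_fps oo fps_X ^ 2 = Phi_fps - fps_X"
proof (rule fps_ext)
  fix n :: nat
  have "(\<exists>k. n = 2 ^ k) \<longleftrightarrow> n = 1 \<or> (even n \<and> (\<exists>k. n div 2 = 2 ^ k))"
  proof
    assume "\<exists>k. n = 2 ^ k"
    then obtain k where "n = 2 ^ k" by blast
    then show "n = 1 \<or> (even n \<and> (\<exists>k. n div 2 = 2 ^ k))"
      by (cases k) auto
  next
    assume "n = 1 \<or> (even n \<and> (\<exists>k. n div 2 = 2 ^ k))"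
    then show "\<exists>k. n = 2 ^ k"
      by (metis dvd_mult_div_cancel power_0 power_Suc)
  qed
  then show "(Phi_fps oo fps_X ^ 2) $ n = (Phi_fps - fps_X) $ n"
    by (auto simp: Phi_fps_def fps_compose_X_square_nth)
qed

text \<open>With Q = t^2 + t + z this is Q^2 + 2 Q + 4 (t^3 + t + z^2). Its origin: if Q(Phi) = 2 S,
  then S^2 = S(z^2) modulo 2, and S(z^2) - S = z^2 - z - z Phi turns this into a relation for Phi
  modulo 8.\<close>

definition quartic :: "'a \<Rightarrow> 'a \<Rightarrow> 'a :: comm_ring_1" where
  "quartic z t = t ^ 4 + 6 * t ^ 3 + (2 * z + 3) * t ^ 2 + (2 * z + 6) * t + 2 * z + 5 * z ^ 2"

lemmas compose_X_square_simps =
  fps_compose_add_distrib fps_compose_mult_distrib fps_compose_power [symmetric]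
  Phi_fps_compose_X_square

text \<open>By the functional equation of Phi, substituting z^2 for z changes this series by an even
  one; as its constant term is 0, it is even itself.\<close>

lemma two_dvd_quadratic_Phi: "2 dvd Phi_fps ^ 2 + Phi_fps + fps_X"
proof -
  let ?Q = "Phi_fps ^ 2 + Phi_fps + fps_X"
  have "(?Q oo fps_X ^ 2) - ?Q = 2 * (fps_X ^ 2 - fps_X - fps_X * Phi_fps)"
    by (simp add: compose_X_square_simps) algebra
  then have "fps_const 2 dvd (?Q oo fps_X ^ 2) - ?Q"
    by (metis dvd_triv_left numeral_fps_const)
  then have "fps_const 2 dvd ?Q"
    by (rule fps_const_dvd_of_compose_X_square) (simp add: power2_eq_square Phi_fps_nth_0)
  then show ?thesis
    by (simp add: numeral_fps_const)
qed

lemma eight_dvd_quartic_Phi: "8 dvd quartic fps_X Phi_fps"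
proof -
  let ?P = "quartic fps_X Phi_fps"
  obtain S where S: "Phi_fps ^ 2 + Phi_fps + fps_X = 2 * S"
    using two_dvd_quadratic_Phi by (elim dvdE)
  have comp: "?P oo fps_X ^ 2 = quartic (fps_X ^ 2) (Phi_fps - fps_X)"
    by (simp add: quartic_def compose_X_square_simps numeral_fps_const)
  \<comment> \<open>\<open>K\<close> collects the part of the difference that is visibly divisible
    by 8. The rest has only a factor 4, and the quadratic relation modulo 2 supplies the missing
    2.\<close>
  define K where "K = fps_X * (fps_X ^ 3 - fps_X ^ 2 * Phi_fps + fps_X * Phi_fps ^ 2 - Phi_fps ^ 3
    - fps_X ^ 2 + 2 * fps_X * Phi_fps - 3 * Phi_fps ^ 2 - Phi_fps - 1)"
  have "(?P oo fps_X ^ 2) - ?P =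
      4 * fps_X * Phi_fps * (Phi_fps ^ 2 + Phi_fps + fps_X) + 8 * K"
    unfolding comp unfolding quartic_def K_def by algebra
  then have "(?P oo fps_X ^ 2) - ?P = 8 * (fps_X * Phi_fps * S + K)"
    unfolding S by algebra
  then have "fps_const 8 dvd (?P oo fps_X ^ 2) - ?P"
    by (metis dvd_triv_left numeral_fps_const)
  then have "fps_const 8 dvd ?P"
    by (rule fps_const_dvd_of_compose_X_square)
      (simp add: quartic_def power_0_left fps_power_zeroth Phi_fps_nth_0)
  then show ?thesis
    by (simp add: numeral_fps_const)
qed

section \<open>Computing with polynomials represented by lists of coefficients\<close>

lemma horner_sum_map: "horner_sum f a (map g xs) = horner_sum (f \<circ> g) a xs"
  by (induction xs) simp_all

text \<open>The coefficient operations are parameters so that the same code and correctness proofs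
  serve first Z[z] and then Z[z][t].\<close>

fun add_with :: "('b \<Rightarrow> 'b \<Rightarrow> 'b) \<Rightarrow> 'b list \<Rightarrow> 'b list \<Rightarrow> 'b list" where
  "add_with f [] ys = ys"
| "add_with f xs [] = xs"
| "add_with f (x # xs) (y # ys) = f x y # add_with f xs ys"

definition mult_with ::
  "('b \<Rightarrow> 'b \<Rightarrow> 'b) \<Rightarrow> ('b \<Rightarrow> 'b \<Rightarrow> 'b) \<Rightarrow> 'b \<Rightarrow> 'b list \<Rightarrow> 'b list \<Rightarrow> 'b list" where
  "mult_with f g e xs ys = foldr (\<lambda>x zs. add_with f (map (g x) ys) (e # zs)) xs []"

text \<open>Only the values under \<open>h\<close> need to obey ring laws: coefficients may
  themselves be lists, which represent polynomials non-uniquely because of trailing zeros.\<close>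

lemma horner_sum_add_with:
  fixes a :: "'a :: comm_ring_1"
  assumes "\<And>x y. h (f x y) = h x + h y"
  shows "horner_sum h a (add_with f xs ys) = horner_sum h a xs + horner_sum h a ys"
  using assms by (induction f xs ys rule: add_with.induct) (simp_all add: algebra_simps)

lemma horner_sum_mult_with:
  fixes a :: "'a :: comm_ring_1"
  assumes "\<And>x y. h (f x y) = h x + h y" and "\<And>x y. h (g x y) = h x * h y" and "h e = 0"
  shows "horner_sum h a (mult_with f g e xs ys) = horner_sum h a xs * horner_sum h a ys"
proof -
  have map: "horner_sum h a (map (g x) ys) = h x * horner_sum h a ys" for x
    by (induction ys) (simp_all add: assms(2) algebra_simps)
  show ?thesis
    by (induction xs)
      (simp_all add: mult_with_def horner_sum_add_with[of h, OF assms(1)] map assms(3)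
        algebra_simps)
qed

abbreviation add_pol :: "int list \<Rightarrow> int list \<Rightarrow> int list" where
  "add_pol \<equiv> add_with (+)"

abbreviation mult_pol :: "int list \<Rightarrow> int list \<Rightarrow> int list" where
  "mult_pol \<equiv> mult_with (+) (*) 0"

abbreviation add_pol2 :: "int list list \<Rightarrow> int list list \<Rightarrow> int list list" where
  "add_pol2 \<equiv> add_with add_pol"

abbreviation mult_pol2 :: "int list list \<Rightarrow> int list list \<Rightarrow> int list list" where
  "mult_pol2 \<equiv> mult_with add_pol mult_pol []"

definition eval_pol :: "'a :: comm_ring_1 \<Rightarrow> int list \<Rightarrow> 'a" where
  "eval_pol = horner_sum of_int"

definition eval_pol2 :: "'a :: comm_ring_1 \<Rightarrow> 'a \<Rightarrow> int list list \<Rightarrow> 'a" where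
  "eval_pol2 z = horner_sum (eval_pol z)"

lemma eval_pol_simps [simp]:
  "eval_pol z [] = 0"
  "eval_pol z (c # cs) = of_int c + z * eval_pol z cs"
  by (simp_all add: eval_pol_def)

lemma eval_pol2_simps [simp]:
  "eval_pol2 z t [] = 0"
  "eval_pol2 z t (c # cs) = eval_pol z c + t * eval_pol2 z t cs"
  by (simp_all add: eval_pol2_def)

lemma eval_pol_add: "eval_pol z (add_pol xs ys) = eval_pol z xs + eval_pol z ys"
  unfolding eval_pol_def by (rule horner_sum_add_with) simp

lemma eval_pol_mult: "eval_pol z (mult_pol xs ys) = eval_pol z xs * eval_pol z ys"
  unfolding eval_pol_def by (rule horner_sum_mult_with) simp_all

lemma eval_pol2_add: "eval_pol2 z t (add_pol2 xs ys) = eval_pol2 z t xs + eval_pol2 z t ys"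
  unfolding eval_pol2_def by (rule horner_sum_add_with) (rule eval_pol_add)

lemma eval_pol2_mult: "eval_pol2 z t (mult_pol2 xs ys) = eval_pol2 z t xs * eval_pol2 z t ys"
  unfolding eval_pol2_def
  by (rule horner_sum_mult_with) (simp_all add: eval_pol_add eval_pol_mult)

lemma eval_pol_map_uminus: "eval_pol z (map uminus xs) = - eval_pol z xs"
  by (induction xs) simp_all

lemma eval_pol2_map_uminus: "eval_pol2 z t (map (map uminus) xs) = - eval_pol2 z t xs"
  by (induction xs) (simp_all add: eval_pol_map_uminus)

lemma eval_pol_fps_to_fls: "eval_pol (fps_to_fls z) xs = fps_to_fls (eval_pol z xs)"
  by (induction xs) (simp_all add: fps_to_fls_of_int fls_times_fps_to_fls)

text \<open>Links the Laurent series of the statement to the power series in which divisibility is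
  treated.\<close>

lemma eval_pol2_fps_to_fls:
  "eval_pol2 (fps_to_fls z) (fps_to_fls t) xs = fps_to_fls (eval_pol2 z t xs)"
  by (induction xs) (simp_all add: eval_pol_fps_to_fls fls_times_fps_to_fls)

lemma dvd_eval_pol:
  assumes "list_all (\<lambda>x. c dvd x) xs"
  shows "of_int c dvd eval_pol z xs"
  using assms by (induction xs) (auto elim!: dvdE intro!: dvd_add dvd_mult)

(* Horner's scheme for the division by the quartic: in t * (q * P + (r0 + r1 t + r2 t^2 + r3 t^3))
   the term r3 t^4 is replaced by r3 * P + r3 * (t^4 - P). *)
definition divmod_quartic ::
  "int list list \<Rightarrow> int list list \<times> int list \<times> int list \<times> int list \<times> int list" where
  "divmod_quartic cs = foldr (\<lambda>c (q, r0, r1, r2, r3).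
     (r3 # q,
      add_pol c (mult_pol [0, -2, -5] r3),
      add_pol r0 (mult_pol [-6, -2] r3),
      add_pol r1 (mult_pol [-3, -2] r3),
      add_pol r2 (mult_pol [-6] r3))) cs ([], [], [], [], [])"

lemma eval_divmod_quartic:
  assumes "divmod_quartic cs = (q, r0, r1, r2, r3)"
  shows "eval_pol2 z t cs = quartic z t * eval_pol2 z t q + eval_pol2 z t [r0, r1, r2, r3]"
  using assms
proof (induction cs arbitrary: q r0 r1 r2 r3)
  case Nil
  then show ?case by (simp add: divmod_quartic_def)
next
  case (Cons c cs)
  obtain q' s0 s1 s2 s3 where *: "divmod_quartic cs = (q', s0, s1, s2, s3)"
    by (metis prod.exhaust)
  have qr: "q = s3 # q'" "r0 = add_pol c (mult_pol [0, -2, -5] s3)"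
    "r1 = add_pol s0 (mult_pol [-6, -2] s3)" "r2 = add_pol s1 (mult_pol [-3, -2] s3)"
    "r3 = add_pol s2 (mult_pol [-6] s3)"
    using Cons.prems * by (simp_all add: divmod_quartic_def)
  have "eval_pol2 z t (c # cs) =
      eval_pol z c + t * (quartic z t * eval_pol2 z t q' + eval_pol2 z t [s0, s1, s2, s3])"
    by (simp add: Cons.IH[OF *])
  also have "\<dots> = quartic z t * eval_pol2 z t q + eval_pol2 z t [r0, r1, r2, r3]"
    unfolding qr quartic_def eval_pol2_simps eval_pol_simps eval_pol_add eval_pol_mult
      of_int_minus of_int_numeral of_int_0
    by (simp add: algebra_simps power2_eq_square power3_eq_cube power4_eq_xxxx)
  finally show ?case .
qed

text \<open>Each further digit is multiplied by one more power of P, which vanishes modulo 8, so the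
  required power of 8 drops by one. The last quotient is unrestricted, as P^n already contributes
  8^n.\<close>

fun quartic_digits_dvd :: "nat \<Rightarrow> int list list \<Rightarrow> bool" where
  "quartic_digits_dvd 0 cs \<longleftrightarrow> True"
| "quartic_digits_dvd (Suc n) cs \<longleftrightarrow> (case divmod_quartic cs of (q, r0, r1, r2, r3) \<Rightarrow>
     list_all (list_all (\<lambda>c. 8 ^ Suc n dvd c)) [r0, r1, r2, r3] \<and> quartic_digits_dvd n q)"

lemma power_8_dvd_eval_pol2:
  fixes z t :: "'a :: comm_ring_1"
  assumes "quartic_digits_dvd n cs" and P: "8 dvd quartic z t"
  shows "8 ^ n dvd eval_pol2 z t cs"
  using assms(1)
proof (induction n arbitrary: cs)
  case (Suc n)
  obtain q r0 r1 r2 r3 where *: "divmod_quartic cs = (q, r0, r1, r2, r3)"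
    by (metis prod.exhaust)
  \<comment> \<open>One factor 8 comes from P, the others from the induction hypothesis for the
    quotient.\<close>
  have "8 * 8 ^ n dvd quartic z t * eval_pol2 z t q"
    using Suc * P by (intro mult_dvd_mono) auto
  moreover have "of_int (8 ^ Suc n) dvd eval_pol z r" if "r \<in> {r0, r1, r2, r3}" for r
    using that Suc.prems * by (intro dvd_eval_pol) auto
  then have "8 ^ Suc n dvd eval_pol2 z t [r0, r1, r2, r3]"
    by (auto intro!: dvd_add dvd_mult)
  ultimately show ?case
    unfolding eval_divmod_quartic[OF *] by (simp add: dvd_add)
qed simp

section \<open>The congruence\<close>

(* Row i lists the coefficients of z a_i(z), starting with the constant term. *)
definition X_cat_coeff_table :: "int list list" where
  "X_cat_coeff_table = [
     [0, 1, 1, 2, 53, 2702, 1042, 2412, 832, 32, 2240, 640, 3584, 2048, 3072, 2048],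
     [0, 0, 0, 3904, 4000, 2512, 3128, 552, 2112, 2112, 0, 3840, 0, 2048],
     [0, 0, 288, 2368, 3416, 3096, 3788, 3440, 4000, 1024, 1152, 1536, 3072, 0, 2048],
     [0, 3904, 3456, 3168, 1032, 3528, 728, 3072, 2752, 512, 2304, 2048, 2048],
     [48, 1600, 3896, 2136, 3154, 3452, 2464, 2272, 1728, 1152, 2048, 1024, 3072, 2048],
     [2272, 3728, 200, 3288, 3648, 1704, 1536, 1088, 1792, 1792, 2048, 2048],
     [2760, 488, 3692, 592, 140, 3824, 1312, 2816, 3200, 1536, 1024, 0, 2048],
     [4024, 1784, 2936, 2128, 2456, 960, 3520, 2304, 2304, 0, 2048],
     [339, 3258, 2646, 1444, 832, 1888, 1088, 3968, 512, 2048, 1024, 2048],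
     [3152, 3992, 1144, 2168, 320, 3008, 1536, 3328, 0, 2048],
     [2380, 3608, 1316, 3408, 3424, 2560, 1408, 512, 3072, 0, 2048],
     [3904, 3880, 1288, 2688, 1856, 3072, 2816, 2048, 2048],
     [358, 948, 224, 1440, 2624, 1408, 2048, 3072, 1024, 2048],
     [2384, 2488, 384, 1984, 2816, 3328, 2048, 2048],
     [260, 336, 3040, 1792, 2432, 512, 1024, 0, 2048],
     [2696, 2752, 64, 256, 768, 0, 2048]]"

lemma X_times_cat_coeff_list:
  "map ((*) fls_X) cat_coeff_list = map (eval_pol fls_X) X_cat_coeff_table"
proof -
  \<comment> \<open>This relation turns the polar terms of the a_i into the constant terms of the
    table rows.\<close>
  have "fls_X * fls_X_inv = (1 :: int fls)"
    by (simp add: fls_X_times_conv_shift)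
  then show ?thesis
    by (simp add: cat_coeff_list_def X_cat_coeff_table_def Let_def algebra_simps
        power_numeral_reduce)
qed

lemma X_times_sum_cat_coeff:
  "fls_X * (\<Sum>i=0..15. cat_coeff i * Phi ^ i) =
     fps_to_fls (eval_pol2 fps_X Phi_fps X_cat_coeff_table)"
proof -
  have *: "{0..15} = {0..<length cat_coeff_list}"
    by (auto simp: length_cat_coeff_list)
  have "fls_X * (\<Sum>i=0..15. cat_coeff i * Phi ^ i) =
      horner_sum ((*) fls_X) Phi cat_coeff_list"
    by (simp add: * horner_sum_eq_sum cat_coeff_def sum_distrib_left mult.assoc)
  also have "\<dots> = horner_sum id Phi (map (eval_pol fls_X) X_cat_coeff_table)"
    by (simp add: horner_sum_map flip: X_times_cat_coeff_list)
  also have "\<dots> = eval_pol2 fls_X Phi X_cat_coeff_table"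
    by (simp add: horner_sum_map eval_pol2_def)
  also have "\<dots> = fps_to_fls (eval_pol2 fps_X Phi_fps X_cat_coeff_table)"
    by (simp add: Phi_eq_fps_to_fls flip: eval_pol2_fps_to_fls)
  finally show ?thesis .
qed

text \<open>The finite computation behind the congruence: the list encodes B^2 - B + z, where
  \<open>[[0, 1]]\<close> stands for z. Its digits are computed exactly over Z; four of them are
  tested since 4096 = 8^4.\<close>

lemma quartic_digits_dvd_table:
  "quartic_digits_dvd 4 (add_pol2 (mult_pol2 X_cat_coeff_table X_cat_coeff_table)
     (add_pol2 (map (map uminus) X_cat_coeff_table) [[0, 1]]))"
  by code_simp

theorem theorem14:
  shows "fls_cong catalan_series (\<Sum>i=0..15. cat_coeff i * Phi ^ i) 4096"
proof -
  define B where "B = eval_pol2 fps_X Phi_fps X_cat_coeff_table"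
  define D where "D = fps_X * catalan_fps"
  have D: "D ^ 2 - D + fps_X = 0"
    unfolding D_def by (rule X_catalan_fps_eqn)
  have "8 ^ 4 dvd B * B + (fps_X - B)"
    using power_8_dvd_eval_pol2[OF quartic_digits_dvd_table eight_dvd_quartic_Phi]
    by (simp add: eval_pol2_add eval_pol2_mult eval_pol2_map_uminus B_def)
  also have "B * B + (fps_X - B) = (B - D) * (B + D - 1)"
    using D by algebra
  finally have "fps_const 4096 dvd (B - D) * (B + D - 1)"
    by (simp add: numeral_fps_const)
  \<comment> \<open>The first table row starts with 0 and Phi has no constant term, so
    \<open>B $ 0 = 0\<close>; also \<open>D $ 0 = 0\<close>. The constant term -1 is its own
    inverse.\<close>
  moreover have "(B + D - 1) $ 0 * (-1) = 1"
    by (simp add: B_def D_def X_cat_coeff_table_def Phi_fps_nth_0)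
  ultimately have "fps_const 4096 dvd B - D"
    by (rule fps_dvd_mult_unit_cancel)
  then have dvd: "4096 dvd B $ n - D $ n" for n
    by (simp add: fps_const_dvd_iff)
  \<comment> \<open>Undoes the multiplication by z; the coefficients at k = -1 become the constant
    terms of \<open>B\<close> and \<open>D\<close>.\<close>
  have shift: "fls_nth f k = fls_nth (fls_X * f) (k + 1)" for f :: "int fls" and k
    by (simp add: fls_X_times_conv_shift)
  have "fls_X * catalan_series = fps_to_fls D"
    by (simp add: catalan_series_def D_def catalan_fps_def fls_times_fps_to_fls)
  then show ?thesis
    unfolding fls_cong_def shift[of catalan_series] shift[of "sum _ _"] X_times_sum_cat_coeff
      B_def[symmetric]
    using dvd by (simp add: cong_iff_dvd_diff dvd_diff_commute)
qed

end
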